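(* Let $K$ be a field, let $p\geq 1$ and let $i_p>i_{p-1}>\cdots>i_1>i_0=0$ be integers. Let $u_j\in K[y,z]$, $0\leq j\leq p-1$, be monomials such that $$u_{p-1}\mid u_{p-2}\mid\cdots\mid u_1\mid u_0$$ and all the divisions are strict. Put $I_j=(u_j)$ for $0\le j\le p-1$. Let $I_p\subset K[y,z]$ be a proper nonzero monomial ideal such that $u_{p-1}\notin I_p$. Consider the ideal $$I=x^{i_p}I_p+(x^{i_{p-1}}u_{p-1},\ldots,x^{i_1}u_1,u_0)\subset R=K[x,y,z],$$ and assume that $$\mathcal{G}(I)=\mathcal{G}(x^{i_p}I_p)\cup\cdots\cup\mathcal{G}(x^{i_1}I_1)\cup\mathcal{G}(I_0).$$ Then $\operatorname{depth}(R/I)=1$.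
   Context: $\mathcal{G}(L)$ denotes the unique minimal set of monomial generators of a monomial ideal $L$. Monomial ideals of $K[y,z]$ are extended to $R$ when used inside $R$: $x^{i_j}I_j$ is the ideal of $R$ generated by the monomials $x^{i_j}u$, $u\in\mathcal G(I_j)$. A division $u\mid v$ is strict if $u\neq v$. Depth is with respect to the graded maximal ideal generated by the variables. *)

theory Defs
  imports
    "HOL-Algebra.Divisibility"
    "HOL-Algebra.QuotRing"
    "HOL-Algebra.Module"
    "HOL-Library.Poly_Mapping"
    "HOL-Library.Extended_Nat"
begin

section \<open>Polynomial rings in finitely many named variables\<close>

text \<open>
  A polynomial is a finitely supported map from exponent vectors to coefficients. All polynomial
  rings over the variable type \<open>'v\<close> live in this one type: the ring with variable set \<open>V\<close>
  is the subring of polynomials whose terms involve only variables from \<open>V\<close>, so that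
  inclusions such as \<open>K[y,z] \<subseteq> K[x,y,z]\<close> are literal.
\<close>

type_synonym ('v, 'k) mpoly = "('v \<Rightarrow>\<^sub>0 nat) \<Rightarrow>\<^sub>0 'k"

definition mpoly_ring :: "'v set \<Rightarrow> ('v, 'k::field) mpoly ring" where
  "mpoly_ring V =
     \<lparr>carrier = {f. \<forall>a \<in> Poly_Mapping.keys f. Poly_Mapping.keys a \<subseteq> V},
      mult = (*), one = 1, zero = 0, add = (+)\<rparr>"

definition mvar :: "'v \<Rightarrow> ('v, 'k::field) mpoly" where
  "mvar v = Poly_Mapping.single (Poly_Mapping.single v 1) 1"

definition monomials :: "'v set \<Rightarrow> ('v, 'k::field) mpoly set" where
  "monomials V = {Poly_Mapping.single a 1 |a. Poly_Mapping.keys a \<subseteq> V}"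


section \<open>Monomial ideals\<close>

definition monomial_ideal :: "'v set \<Rightarrow> ('v, 'k::field) mpoly set \<Rightarrow> bool" where
  "monomial_ideal V L \<longleftrightarrow> (\<exists>A \<subseteq> monomials V. L = Idl\<^bsub>mpoly_ring V\<^esub> A)"

text \<open>The unique minimal set of monomial generators of a monomial ideal \<open>L\<close> of
  \<open>mpoly_ring V\<close>; the value is meaningful only for monomial ideals.\<close>

definition min_gens :: "'v set \<Rightarrow> ('v, 'k::field) mpoly set \<Rightarrow> ('v, 'k) mpoly set" where
  "min_gens V L =
     (THE G. G \<subseteq> monomials V \<and> Idl\<^bsub>mpoly_ring V\<^esub> G = L \<and>
        (\<forall>H. H \<subset> G \<longrightarrow> Idl\<^bsub>mpoly_ring V\<^esub> H \<noteq> L))"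


section \<open>Depth\<close>

text \<open>The submodule \<open>(f\<^sub>1, \<dots>, f\<^sub>n) M\<close> of \<open>M\<close>.\<close>

definition list_smult :: "('c, 'd) module \<Rightarrow> 'c list \<Rightarrow> 'd set" where
  "list_smult M fs =
     {(\<Oplus>\<^bsub>M\<^esub>i\<in>{..<length fs}. fs ! i \<odot>\<^bsub>M\<^esub> g i) |g. g \<in> {..<length fs} \<rightarrow> carrier M}"

text \<open>The second conjunct says that \<open>f\<^sub>i\<close> is a nonzerodivisor on
  \<open>M / (f\<^sub>1, \<dots>, f\<^bsub>i-1\<^esub>) M\<close>, written without forming that quotient module.\<close>

definition regular_sequence :: "'c ring \<Rightarrow> ('c, 'd) module \<Rightarrow> 'c list \<Rightarrow> bool" where
  "regular_sequence R M fs \<longleftrightarrow>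
     set fs \<subseteq> carrier R \<and>
     (\<forall>i < length fs. \<forall>m \<in> carrier M.
        fs ! i \<odot>\<^bsub>M\<^esub> m \<in> list_smult M (take i fs) \<longrightarrow> m \<in> list_smult M (take i fs)) \<and>
     list_smult M fs \<noteq> carrier M"

text \<open>The zero module has no regular sequence here, so it gets depth \<open>0\<close> (instead of the
  frequent convention \<open>\<infinity>\<close>).\<close>

definition depth :: "'c ring \<Rightarrow> 'c set \<Rightarrow> ('c, 'd) module \<Rightarrow> enat" where
  "depth R \<mm> M =
     Sup {enat (length fs) |fs. set fs \<subseteq> \<mm> \<and> regular_sequence R M fs}"

text \<open>\<open>R / I\<close> as an \<open>R\<close>-module.\<close>

definition quot_module :: "'c ring \<Rightarrow> 'c set \<Rightarrow> ('c, 'c set) module" where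
  "quot_module R I =
     \<lparr>carrier = carrier (R Quot I), mult = mult (R Quot I), one = one (R Quot I),
      zero = zero (R Quot I), add = add (R Quot I),
      smult = (\<lambda>r C. (I +>\<^bsub>R\<^esub> r) \<otimes>\<^bsub>R Quot I\<^esub> C)\<rparr>"


section \<open>The rings \<open>K[x,y,z]\<close> and \<open>K[y,z]\<close>\<close>

datatype xyz = VX | VY | VZ

abbreviation Kxyz :: "(xyz, 'k::field) mpoly ring" where
  "Kxyz \<equiv> mpoly_ring {VX, VY, VZ}"

abbreviation Kyz :: "(xyz, 'k::field) mpoly ring" where
  "Kyz \<equiv> mpoly_ring {VY, VZ}"

abbreviation max_ideal_xyz :: "(xyz, 'k::field) mpoly set" where
  "max_ideal_xyz \<equiv> Idl\<^bsub>Kxyz\<^esub> {mvar VX, mvar VY, mvar VZ}"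

text \<open>For a monomial ideal \<open>L\<close> of \<open>K[y,z]\<close>, the ideal \<open>x\<^sup>n L\<close> of \<open>K[x,y,z]\<close>;
  \<open>n = 0\<close> gives the extension of \<open>L\<close>.\<close>

definition xpow_ext :: "nat \<Rightarrow> (xyz, 'k::field) mpoly set \<Rightarrow> (xyz, 'k) mpoly set" where
  "xpow_ext n L =
     Idl\<^bsub>Kxyz\<^esub> ((\<lambda>u. mvar VX [^]\<^bsub>Kxyz\<^esub> n \<otimes>\<^bsub>Kxyz\<^esub> u) ` min_gens {VY, VZ} L)"

end

theory Submission
  imports Defs
begin

text \<open>
  Membership in \<open>I\<close> can be read off exponent by exponent. In \<open>x\<close>-degree \<open>a < i\<^sub>p\<close> the ideal is
  principal, generated by the last \<open>u\<^sub>j\<close> with \<open>i\<^sub>j \<le> a\<close>, because the \<open>u\<^sub>j\<close> form a divisibility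
  chain; from \<open>x\<close>-degree \<open>i\<^sub>p\<close> on it is constant, equal to \<open>T = I\<^sub>p + (u\<^bsub>p-1\<^esub>)\<close>.

  Depth at least one: \<open>x + y + z\<close> is a nonzerodivisor on \<open>R/I\<close>
  (\<open>sum_of_variables_nonzerodivisor\<close>). If \<open>(x + y + z) f \<in> I\<close>, then a term of \<open>f\<close> outside \<open>I\<close>
  that is extremal in a suitable direction can be multiplied by one variable without cancellation,
  so that multiple lies in \<open>I\<close>. Where the ideal is constant in \<open>x\<close> the variable is \<open>x\<close>; in a
  principal slice \<open>(y\<^sup>B z\<^sup>C)\<close> it is whichever of \<open>y\<close> and \<open>z\<close> does not repair the exponent that
  is too small. In both cases the term itself was already in \<open>I\<close>.

  Depth at most one: the hypothesis on the generators makes some generator \<open>v\<close> of \<open>I\<^sub>p\<close> a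
  nonmultiple of \<open>u\<^bsub>p-1\<^esub>\<close>, and \<open>v\<close> does not divide \<open>u\<^bsub>p-1\<^esub>\<close> because \<open>u\<^bsub>p-1\<^esub> \<notin> I\<^sub>p\<close>. So the
  staircase of \<open>T\<close> has an inner corner \<open>w\<close>: \<open>w \<notin> T\<close> but \<open>y w, z w \<in> T\<close>
  (\<open>staircase_corner\<close>). Hence \<open>x\<^sup>n w\<close>, for \<open>n = i\<^sub>p\<close>, is killed by \<open>y\<close> and \<open>z\<close> in \<open>R/I\<close>,
  and \<open>(y, z)\<close> is an associated prime with \<open>R/(y, z)\<close> of dimension one. The bound on the depth
  that this gives is obtained by hand in \<open>depth_quot_le_one\<close>, without dimension theory.
\<close>

section \<open>Regular sequences on a cyclic module\<close>

lemma (in cring) genideal_Un: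
  assumes "A \<subseteq> carrier R" "B \<subseteq> carrier R"
  shows "Idl (A \<union> B) = Idl A <+>\<^bsub>R\<^esub> Idl B"
proof
  have id: "ideal (Idl A) R" "ideal (Idl B) R" "ideal (Idl (A \<union> B)) R"
    using assms by (auto intro: genideal_ideal)
  have sum: "Idl (Idl A \<union> Idl B) = Idl A <+>\<^bsub>R\<^esub> Idl B"
    using id by (intro union_genideal)
  have sub: "Idl A \<union> Idl B \<subseteq> carrier R"
    using id by (auto dest: ideal.Icarr)
  have "A \<union> B \<subseteq> Idl (Idl A \<union> Idl B)"
    using genideal_self[OF sub] genideal_self[OF assms(1)] genideal_self[OF assms(2)] by blast
  thus "Idl (A \<union> B) \<subseteq> Idl A <+>\<^bsub>R\<^esub> Idl B"
    using genideal_minimal[OF genideal_ideal[OF sub]] sum by simp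
  have "Idl A \<union> Idl B \<subseteq> Idl (A \<union> B)"
    using genideal_minimal[OF id(3)] genideal_self[of "A \<union> B"] assms by simp
  thus "Idl A <+>\<^bsub>R\<^esub> Idl B \<subseteq> Idl (A \<union> B)"
    using genideal_minimal[OF id(3)] sum by metis
qed

text \<open>The record extension of \<open>R\<close> is fixed to be trivial because \<^const>\<open>quot_module\<close> takes a
  plain ring record.\<close>

locale quotient_module = cring R + ideal I R for R :: "'a ring" (structure) and I
begin

lemma quot_module_carrier: "carrier (quot_module R I) = {I +> g |g. g \<in> carrier R}"
  by (auto simp: quot_module_def FactRing_def A_RCOSETS_def')

lemma quot_module_smult:
  "a \<in> carrier R \<Longrightarrow> g \<in> carrier R \<Longrightarrow> a \<odot>\<^bsub>quot_module R I\<^esub> (I +> g) = I +> (a \<otimes> g)"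
  by (simp add: quot_module_def FactRing_def rcoset_mult_add)

lemma quot_module_abelian_group: "abelian_group (quot_module R I)"
proof -
  interpret Q: ring "R Quot I" by (rule quotient_is_ring)
  show ?thesis
    by (rule abelian_groupI)
       (simp_all add: quot_module_def Q.a_ac Q.a_closed Q.add.l_inv_ex)
qed

lemma quot_module_zero: "\<zero>\<^bsub>quot_module R I\<^esub> = I"
  by (simp add: quot_module_def FactRing_def)

lemma list_smult_quot_Nil: "list_smult (quot_module R I) [] = {I}"
proof -
  interpret M: abelian_group "quot_module R I" by (rule quot_module_abelian_group)
  show ?thesis by (auto simp: list_smult_def quot_module_zero)
qed

lemma list_smult_quot_single:
  assumes a: "a \<in> carrier R"
  shows "list_smult (quot_module R I) [a] = {I +> (a \<otimes> r) |r. r \<in> carrier R}"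
proof -
  interpret M: abelian_group "quot_module R I" by (rule quot_module_abelian_group)
  have sum: "(\<Oplus>\<^bsub>quot_module R I\<^esub>i\<in>{..<length [a]}. [a] ! i \<odot>\<^bsub>quot_module R I\<^esub> g i)
        = a \<odot>\<^bsub>quot_module R I\<^esub> g 0"
    if "g 0 \<in> carrier (quot_module R I)" for g
  proof -
    have "a \<odot>\<^bsub>quot_module R I\<^esub> g 0 \<in> carrier (quot_module R I)"
      using that a by (auto simp: quot_module_carrier quot_module_smult)
    thus ?thesis by (simp add: lessThan_Suc)
  qed
  show ?thesis
  proof (intro equalityI subsetI)
    fix C assume "C \<in> list_smult (quot_module R I) [a]"
    then obtain g where g: "g \<in> {..<length [a]} \<rightarrow> carrier (quot_module R I)"
      and C: "C = (\<Oplus>\<^bsub>quot_module R I\<^esub>i\<in>{..<length [a]}. [a] ! i \<odot>\<^bsub>quot_module R I\<^esub> g i)"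
      unfolding list_smult_def by blast
    have g0: "g 0 \<in> carrier (quot_module R I)" using g by auto
    then obtain r where "r \<in> carrier R" "g 0 = I +> r" by (auto simp: quot_module_carrier)
    thus "C \<in> {I +> (a \<otimes> r) |r. r \<in> carrier R}"
      using C sum[of g, OF g0] quot_module_smult[OF a] by auto
  next
    fix C assume "C \<in> {I +> (a \<otimes> r) |r. r \<in> carrier R}"
    then obtain r where r: "r \<in> carrier R" "C = I +> (a \<otimes> r)" by blast
    have g0: "I +> r \<in> carrier (quot_module R I)" using r by (auto simp: quot_module_carrier)
    have "C = (\<Oplus>\<^bsub>quot_module R I\<^esub>i\<in>{..<length [a]}. [a] ! i \<odot>\<^bsub>quot_module R I\<^esub> (I +> r))"
      using sum[of "\<lambda>_. I +> r", OF g0] r a by (simp add: quot_module_smult)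
    thus "C \<in> list_smult (quot_module R I) [a]"
      unfolding list_smult_def using g0 by (intro CollectI exI[of _ "\<lambda>_. I +> r"]) auto
  qed
qed

lemma coset_in_list_smult_Nil:
  "g \<in> carrier R \<Longrightarrow> I +> g \<in> list_smult (quot_module R I) [] \<longleftrightarrow> g \<in> I"
  using a_rcos_self[of g] a_rcos_const[of g] by (auto simp: list_smult_quot_Nil)

lemma coset_in_list_smult_single:
  "a \<in> carrier R \<Longrightarrow> g \<in> carrier R \<Longrightarrow>
     I +> g \<in> list_smult (quot_module R I) [a] \<longleftrightarrow> (\<exists>r\<in>carrier R. g \<ominus> a \<otimes> r \<in> I)"
  by (auto simp: list_smult_quot_single quotient_eq_iff_same_a_r_cos[OF ideal_axioms])

lemma regular_sequence_quot_single:
  assumes "a \<in> carrier R" "\<And>g. g \<in> carrier R \<Longrightarrow> a \<otimes> g \<in> I \<Longrightarrow> g \<in> I"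
    and proper: "\<And>r. r \<in> carrier R \<Longrightarrow> \<one> \<ominus> a \<otimes> r \<notin> I"
  shows "regular_sequence R (quot_module R I) [a]"
proof -
  have "I +> \<one> \<notin> list_smult (quot_module R I) [a]"
    using proper assms(1) by (simp add: coset_in_list_smult_single)
  moreover have "I +> \<one> \<in> carrier (quot_module R I)" by (auto simp: quot_module_carrier)
  ultimately have "list_smult (quot_module R I) [a] \<noteq> carrier (quot_module R I)" by metis
  moreover have "m \<in> list_smult (quot_module R I) []"
    if m: "m \<in> carrier (quot_module R I)"
      and am: "a \<odot>\<^bsub>quot_module R I\<^esub> m \<in> list_smult (quot_module R I) []" for m
  proof -
    obtain g where g: "g \<in> carrier R" "m = I +> g" using m by (auto simp: quot_module_carrier)
    have "a \<otimes> g \<in> I"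
      using am assms(1) g by (simp add: quot_module_smult coset_in_list_smult_Nil)
    from assms(2)[OF g(1) this] show ?thesis using g by (simp add: coset_in_list_smult_Nil)
  qed
  ultimately show ?thesis
    using assms(1) by (simp add: regular_sequence_def)
qed

text \<open>Regularity of the first two terms, transported from cosets to representatives: equalities in
  \<open>R/I\<close> become memberships in \<open>I\<close>, and \<open>a (R/I)\<close> becomes the ideal \<open>a R + I\<close>.\<close>

lemma regular_sequence_quot_Cons2D:
  assumes reg: "regular_sequence R (quot_module R I) (a # b # fs)"
  shows "a \<in> carrier R" "b \<in> carrier R"
    and "\<And>g. g \<in> carrier R \<Longrightarrow> a \<otimes> g \<in> I \<Longrightarrow> g \<in> I"
    and "\<And>g r. \<lbrakk>g \<in> carrier R; r \<in> carrier R; b \<otimes> g \<ominus> a \<otimes> r \<in> I\<rbrakk> \<Longrightarrow>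
           \<exists>s\<in>carrier R. g \<ominus> a \<otimes> s \<in> I"
proof -
  show ab: "a \<in> carrier R" "b \<in> carrier R"
    using reg by (auto simp: regular_sequence_def)
  have step: "\<And>i m. i < length (a # b # fs) \<Longrightarrow> m \<in> carrier (quot_module R I) \<Longrightarrow>
      (a # b # fs) ! i \<odot>\<^bsub>quot_module R I\<^esub> m \<in> list_smult (quot_module R I) (take i (a # b # fs)) \<Longrightarrow>
      m \<in> list_smult (quot_module R I) (take i (a # b # fs))"
    using reg unfolding regular_sequence_def by blast
  show "g \<in> I" if g: "g \<in> carrier R" "a \<otimes> g \<in> I" for g
    using step[of 0 "I +> g"] ab g
    by (auto simp: quot_module_carrier quot_module_smult coset_in_list_smult_Nil)
  show "\<exists>s\<in>carrier R. g \<ominus> a \<otimes> s \<in> I"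
    if g: "g \<in> carrier R" and r: "r \<in> carrier R" and gr: "b \<otimes> g \<ominus> a \<otimes> r \<in> I" for g r
    using step[of 1 "I +> g"] ab g r gr
    by (auto simp: quot_module_carrier quot_module_smult coset_in_list_smult_single)
qed

lemma I_minus_closed: "a \<in> I \<Longrightarrow> b \<in> I \<Longrightarrow> a \<ominus> b \<in> I"
  unfolding minus_eq
  by (rule additive_subgroup.a_closed[OF is_additive_subgroup]
       additive_subgroup.a_inv_closed[OF is_additive_subgroup] | assumption)+

lemma annihilator_genideal:
  assumes "Q \<subseteq> carrier R" "c \<in> carrier R" "\<And>q. q \<in> Q \<Longrightarrow> q \<otimes> c \<in> I"
    and "q \<in> Idl Q"
  shows "q \<otimes> c \<in> I"
proof -
  have "ideal {q \<in> carrier R. q \<otimes> c \<in> I} R"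
  proof (rule idealI[OF ring_axioms])
    show "subgroup {q \<in> carrier R. q \<otimes> c \<in> I} (add_monoid R)"
      by (rule add.subgroupI) (use assms(2) in \<open>auto simp: l_distr l_minus\<close>)
  next
    fix a b assume "a \<in> {q \<in> carrier R. q \<otimes> c \<in> I}" "b \<in> carrier R"
    moreover from this have "b \<otimes> a \<otimes> c = b \<otimes> (a \<otimes> c)" "a \<otimes> b \<otimes> c = b \<otimes> (a \<otimes> c)"
      using assms(2) by (auto simp: m_ac)
    ultimately show "b \<otimes> a \<in> {q \<in> carrier R. q \<otimes> c \<in> I}" "a \<otimes> b \<in> {q \<in> carrier R. q \<otimes> c \<in> I}"
      by (auto intro: I_l_closed)
  qed
  moreover have "Q \<subseteq> {q \<in> carrier R. q \<otimes> c \<in> I}" using assms by auto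
  ultimately show ?thesis using genideal_minimal assms(4) by blast
qed

text \<open>
  Let \<open>N\<close> be the submodule of \<open>R/I\<close> annihilated by \<open>Q\<close>, and \<open>c \<in> N\<close> with \<open>c \<notin> x N\<close>. On \<open>N\<close>
  every element of \<open>\<mm>\<close> acts as a multiple of \<open>x\<close>, say \<open>f\<^sub>1\<close> as \<open>x b\<^sub>1\<close> and \<open>f\<^sub>2\<close> as \<open>x b\<^sub>2\<close>.
  Then \<open>f\<^sub>2 (b\<^sub>1 c) = x b\<^sub>1 b\<^sub>2 c = f\<^sub>1 (b\<^sub>2 c)\<close>, so if \<open>f\<^sub>1, f\<^sub>2\<close> were regular there would be an
  \<open>s\<close> with \<open>b\<^sub>1 c = f\<^sub>1 s\<close>. Multiplying by \<open>x\<close> and by \<open>Q\<close> and cancelling \<open>f\<^sub>1\<close> shows \<open>c = x s\<close>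
  and \<open>s \<in> N\<close>, against the choice of \<open>c\<close>.
\<close>

lemma depth_quot_le_one:
  assumes x: "x \<in> carrier R" and Q: "Q \<subseteq> carrier R"
    and \<mm>: "\<mm> \<subseteq> Idl (insert x Q)"
    and c: "c \<in> carrier R" "\<And>q. q \<in> Q \<Longrightarrow> q \<otimes> c \<in> I"
    and not_mult: "\<And>m. \<lbrakk>m \<in> carrier R; \<And>q. q \<in> Q \<Longrightarrow> q \<otimes> m \<in> I\<rbrakk> \<Longrightarrow> c \<ominus> x \<otimes> m \<notin> I"
  shows "depth R \<mm> (quot_module R I) \<le> 1"
proof -
  have decomp: "\<exists>b q. b \<in> carrier R \<and> q \<in> carrier R \<and> q \<otimes> c \<in> I \<and> f = x \<otimes> b \<oplus> q" if "f \<in> \<mm>" for f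
  proof -
    have "f \<in> Idl ({x} \<union> Q)" using that \<mm> by auto
    hence "f \<in> Idl {x} <+>\<^bsub>R\<^esub> Idl Q" using genideal_Un[of "{x}" Q] x Q by simp
    then obtain h q where hq: "h \<in> Idl {x}" "q \<in> Idl Q" "f = h \<oplus> q"
      by (auto simp: set_add_def')
    then obtain b where b: "b \<in> carrier R" "h = b \<otimes> x"
      using cgenideal_eq_genideal[OF x] by (auto simp: cgenideal_def)
    have "q \<otimes> c \<in> I" using annihilator_genideal[OF Q c hq(2)] .
    moreover have "q \<in> carrier R" using genideal_ideal[OF Q] hq(2) by (rule ideal.Icarr)
    ultimately show ?thesis using b hq(3) m_comm[OF b(1) x] by auto
  qed
  have short: "length fs \<le> 1"
    if fs: "set fs \<subseteq> \<mm>" and reg: "regular_sequence R (quot_module R I) fs" for fs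
  proof (rule ccontr)
    assume "\<not> length fs \<le> 1"
    then obtain f1 f2 fs' where fs_eq: "fs = f1 # f2 # fs'"
      by (cases fs; cases "tl fs") auto
    note R = regular_sequence_quot_Cons2D[OF reg[unfolded fs_eq]]
    obtain b1 q1 where 1: "b1 \<in> carrier R" "q1 \<in> carrier R" "q1 \<otimes> c \<in> I" "f1 = x \<otimes> b1 \<oplus> q1"
      using decomp[of f1] fs fs_eq by auto
    obtain b2 q2 where 2: "b2 \<in> carrier R" "q2 \<in> carrier R" "q2 \<otimes> c \<in> I" "f2 = x \<otimes> b2 \<oplus> q2"
      using decomp[of f2] fs fs_eq by auto
    have "f2 \<otimes> (b1 \<otimes> c) \<ominus> f1 \<otimes> (b2 \<otimes> c) = b1 \<otimes> (q2 \<otimes> c) \<ominus> b2 \<otimes> (q1 \<otimes> c)"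
      using 1 2 x c(1) by algebra
    also have "\<dots> \<in> I"
      by (intro I_minus_closed I_l_closed 1(1,3) 2(1,3))
    finally obtain s where s: "s \<in> carrier R" "b1 \<otimes> c \<ominus> f1 \<otimes> s \<in> I"
      using R(4)[of "b1 \<otimes> c" "b2 \<otimes> c"] 1(1) 2(1) c(1) by blast
    \<comment> \<open>Cancelling \<open>f\<^sub>1\<close> from \<open>f\<^sub>1 c = x b\<^sub>1 c = f\<^sub>1 (x s)\<close>, an equation modulo \<open>I\<close>.\<close>
    have "f1 \<otimes> (c \<ominus> x \<otimes> s) = x \<otimes> (b1 \<otimes> c \<ominus> f1 \<otimes> s) \<oplus> q1 \<otimes> c"
      unfolding 1(4) using 1(1,2) s(1) x c(1) by algebra
    also have "\<dots> \<in> I" by (intro additive_subgroup.a_closed[OF is_additive_subgroup] I_l_closed s(2) x 1(3))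
    finally have "c \<ominus> x \<otimes> s \<in> I" by (rule R(3)[rotated]) (use c(1) x s(1) in simp)
    moreover have "q \<otimes> s \<in> I" if q: "q \<in> Q" for q
    proof -
      have qR: "q \<in> carrier R" using q Q by auto
      have "f1 \<otimes> (q \<otimes> s) = b1 \<otimes> (q \<otimes> c) \<ominus> q \<otimes> (b1 \<otimes> c \<ominus> f1 \<otimes> s)"
        using 1(1) s(1) R(1) qR c(1) by algebra
      also have "\<dots> \<in> I"
        by (intro I_minus_closed I_l_closed 1(1) s(2) c(2)[OF q] qR)
      finally show ?thesis by (rule R(3)[rotated]) (use qR s(1) in simp)
    qed
    ultimately show False using not_mult s(1) by blast
  qed
  show ?thesis
    unfolding depth_def by (rule Sup_least) (use short in \<open>auto simp: one_enat_def\<close>)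
qed

lemma one_le_depth_quot:
  assumes "a \<in> \<mm>" "a \<in> carrier R" "\<And>g. g \<in> carrier R \<Longrightarrow> a \<otimes> g \<in> I \<Longrightarrow> g \<in> I"
    and "\<And>r. r \<in> carrier R \<Longrightarrow> \<one> \<ominus> a \<otimes> r \<notin> I"
  shows "1 \<le> depth R \<mm> (quot_module R I)"
  unfolding depth_def
  by (rule Sup_upper)
     (intro CollectI exI[of _ "[a]"] conjI regular_sequence_quot_single[OF assms(2-4)],
       simp_all add: one_enat_def assms(1))

end

section \<open>Monomial ideals through exponents\<close>

abbreviation monom_of :: "('v \<Rightarrow>\<^sub>0 nat) \<Rightarrow> ('v, 'k::field) mpoly" where
  "monom_of a \<equiv> Poly_Mapping.single a 1"

text \<open>Divisibility of monomials. The order that the type class of finitely supported maps provides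
  is lexicographic, hence a separate relation.\<close>

definition exp_le :: "('v \<Rightarrow>\<^sub>0 nat) \<Rightarrow> ('v \<Rightarrow>\<^sub>0 nat) \<Rightarrow> bool" (infix "\<preceq>" 50) where
  "a \<preceq> b \<longleftrightarrow> (\<forall>v. Poly_Mapping.lookup a v \<le> Poly_Mapping.lookup b v)"

definition multiples :: "('v \<Rightarrow>\<^sub>0 nat) set \<Rightarrow> ('v \<Rightarrow>\<^sub>0 nat) set" where
  "multiples A = {k. \<exists>a\<in>A. a \<preceq> k}"

definition minimal_exps :: "('v \<Rightarrow>\<^sub>0 nat) set \<Rightarrow> ('v \<Rightarrow>\<^sub>0 nat) set" where
  "minimal_exps A = {a \<in> A. \<forall>b\<in>A. b \<preceq> a \<longrightarrow> b = a}"

lemma exp_le_refl: "a \<preceq> a"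
  by (simp add: exp_le_def)

lemma exp_le_trans: "a \<preceq> b \<Longrightarrow> b \<preceq> c \<Longrightarrow> a \<preceq> c"
  unfolding exp_le_def using order_trans by blast

lemma exp_le_antisym: "a \<preceq> b \<Longrightarrow> b \<preceq> a \<Longrightarrow> a = b"
  unfolding exp_le_def by (intro poly_mapping_eqI order_antisym) auto

lemma exp_le_add: "a \<preceq> a + b"
  by (simp add: exp_le_def lookup_add)

lemma exp_le_add_diff: "a \<preceq> k \<Longrightarrow> a + (k - a) = k"
  by (intro poly_mapping_eqI) (simp add: exp_le_def lookup_add lookup_minus)

lemma keys_add_exp: "Poly_Mapping.keys (a + b :: 'v \<Rightarrow>\<^sub>0 nat) = Poly_Mapping.keys a \<union> Poly_Mapping.keys b"
  by (auto simp: in_keys_iff lookup_add)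

lemma multiples_mono: "k \<in> multiples A \<Longrightarrow> k \<preceq> l \<Longrightarrow> l \<in> multiples A"
  unfolding multiples_def using exp_le_trans by blast

lemma subset_multiples: "A \<subseteq> multiples A"
  unfolding multiples_def using exp_le_refl by blast

lemma multiples_Un: "multiples (A \<union> B) = multiples A \<union> multiples B"
  by (auto simp: multiples_def)

text \<open>Every element of \<open>A\<close> below \<open>k\<close> is supported on the variables of \<open>k\<close>, so total degree on
  these finitely many variables is a measure that strict divisibility decreases.\<close>

lemma minimal_exps_below:
  assumes "k \<in> multiples A"
  shows "k \<in> multiples (minimal_exps A)"
proof -
  define deg where "deg a = (\<Sum>v\<in>Poly_Mapping.keys k. Poly_Mapping.lookup a v)" for a :: "'a \<Rightarrow>\<^sub>0 nat"
  obtain a0 where a0: "a0 \<in> A \<and> a0 \<preceq> k" using assms by (auto simp: multiples_def)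
  obtain a where a: "a \<in> A" "a \<preceq> k"
    and least: "\<And>b. b \<in> A \<Longrightarrow> b \<preceq> k \<Longrightarrow> deg a \<le> deg b"
    using ex_has_least_nat[of "\<lambda>a. a \<in> A \<and> a \<preceq> k", OF a0, of deg] by metis
  have "b = a" if b: "b \<in> A" "b \<preceq> a" for b
  proof (rule ccontr)
    assume "b \<noteq> a"
    then obtain v where v: "Poly_Mapping.lookup b v \<noteq> Poly_Mapping.lookup a v"
      using poly_mapping_eqI[of b a] by metis
    with b(2) have less: "Poly_Mapping.lookup b v < Poly_Mapping.lookup a v"
      by (simp add: exp_le_def order.not_eq_order_implies_strict)
    also have "\<dots> \<le> Poly_Mapping.lookup k v" using a(2) by (simp add: exp_le_def)
    finally have "v \<in> Poly_Mapping.keys k" by (simp add: in_keys_iff)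
    hence "deg b < deg a"
      unfolding deg_def using b(2) less by (intro sum_strict_mono_ex1) (auto simp: exp_le_def)
    moreover have "deg a \<le> deg b" using least b a(2) exp_le_trans by blast
    ultimately show False by simp
  qed
  hence "a \<in> minimal_exps A" using a(1) by (auto simp: minimal_exps_def)
  thus ?thesis using a(2) by (auto simp: multiples_def)
qed

lemma multiples_minimal_exps: "multiples (minimal_exps A) = multiples A"
proof
  show "multiples (minimal_exps A) \<subseteq> multiples A"
    by (auto simp: multiples_def minimal_exps_def)
qed (use minimal_exps_below in blast)

lemma lookup_monom_mult:
  "Poly_Mapping.lookup (monom_of a * f) k
     = (if a \<preceq> k then Poly_Mapping.lookup f (k - a) else 0)"
proof -
  have "Poly_Mapping.lookup (monom_of a * f) k = (\<Sum>q. Poly_Mapping.lookup f q when k = a + q)"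
    by (simp add: lookup_mult lookup_single when_mult)
  also have "\<dots> = (if a \<preceq> k then Poly_Mapping.lookup f (k - a) else 0)"
  proof (cases "a \<preceq> k")
    case True
    hence "k = a + q \<longleftrightarrow> k - a = q" for q using exp_le_add_diff[OF True] by auto
    thus ?thesis using True by simp
  next
    case False
    hence "k \<noteq> a + q" for q using exp_le_add[of a q] by auto
    thus ?thesis using False by simp
  qed
  finally show ?thesis .
qed

lemma keys_monom_mult: "Poly_Mapping.keys (monom_of a * f) = (+) a ` Poly_Mapping.keys f"
proof (intro equalityI subsetI)
  fix k assume "k \<in> Poly_Mapping.keys (monom_of a * f)"
  hence "a \<preceq> k" "k - a \<in> Poly_Mapping.keys f"
    by (auto simp: in_keys_iff lookup_monom_mult split: if_splits)
  thus "k \<in> (+) a ` Poly_Mapping.keys f" by (metis exp_le_add_diff imageI)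
qed (auto simp: in_keys_iff lookup_monom_mult exp_le_add)

lemma keys_uminus_mpoly: "Poly_Mapping.keys (- f :: ('v, 'k::field) mpoly) = Poly_Mapping.keys f"
  by (simp add: keys_def)

lemma mpoly_ring_simps [simp]:
  "f \<otimes>\<^bsub>mpoly_ring V\<^esub> g = f * g" "\<one>\<^bsub>mpoly_ring V\<^esub> = 1"
  "f \<oplus>\<^bsub>mpoly_ring V\<^esub> g = f + g" "\<zero>\<^bsub>mpoly_ring V\<^esub> = 0"
  by (simp_all add: mpoly_ring_def)

lemma mpoly_ring_carrier:
  "f \<in> carrier (mpoly_ring V) \<longleftrightarrow> (\<forall>a\<in>Poly_Mapping.keys f. Poly_Mapping.keys a \<subseteq> V)"
  by (simp add: mpoly_ring_def)

lemma keys_mult_mpoly: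
  fixes f g :: "('v, 'k::field) mpoly"
  assumes "k \<in> Poly_Mapping.keys (f * g)"
  obtains a b where "a \<in> Poly_Mapping.keys f" "b \<in> Poly_Mapping.keys g" "k = a + b"
  using assms keys_mult[of f g] by blast

lemma cring_mpoly_ring: "cring (mpoly_ring V :: ('v, 'k::field) mpoly ring)"
proof (rule cringI)
  show "abelian_group (mpoly_ring V :: ('v, 'k) mpoly ring)"
  proof (rule abelian_groupI)
    fix f :: "('v, 'k) mpoly" assume "f \<in> carrier (mpoly_ring V)"
    thus "\<exists>g\<in>carrier (mpoly_ring V). g \<oplus>\<^bsub>mpoly_ring V\<^esub> f = \<zero>\<^bsub>mpoly_ring V\<^esub>"
      by (intro bexI[of _ "- f"]) (auto simp: mpoly_ring_carrier keys_uminus_mpoly)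
  next
    fix f g :: "('v, 'k) mpoly"
    assume "f \<in> carrier (mpoly_ring V)" "g \<in> carrier (mpoly_ring V)"
    thus "f \<oplus>\<^bsub>mpoly_ring V\<^esub> g \<in> carrier (mpoly_ring V)"
      using keys_add[of f g] by (auto simp: mpoly_ring_carrier)
  qed (auto simp: mpoly_ring_carrier add_ac)
  show "Group.comm_monoid (mpoly_ring V :: ('v, 'k) mpoly ring)"
  proof (rule comm_monoidI)
    fix f g :: "('v, 'k) mpoly"
    assume "f \<in> carrier (mpoly_ring V)" "g \<in> carrier (mpoly_ring V)"
    thus "f \<otimes>\<^bsub>mpoly_ring V\<^esub> g \<in> carrier (mpoly_ring V)"
      by (auto simp: mpoly_ring_carrier keys_add_exp elim!: keys_mult_mpoly) blast+
  qed (auto simp: mpoly_ring_carrier mult_ac)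
qed (auto simp: distrib_right)

lemma mpoly_ring_a_inv:
  assumes "f \<in> carrier (mpoly_ring V)"
  shows "\<ominus>\<^bsub>mpoly_ring V\<^esub> f = - f"
proof -
  interpret cring "mpoly_ring V" by (rule cring_mpoly_ring)
  show ?thesis
    using assms by (intro minus_equality) (auto simp: mpoly_ring_carrier keys_uminus_mpoly)
qed

lemma mpoly_ring_minus:
  "f \<in> carrier (mpoly_ring V) \<Longrightarrow> g \<in> carrier (mpoly_ring V) \<Longrightarrow> f \<ominus>\<^bsub>mpoly_ring V\<^esub> g = f - g"
  by (simp add: a_minus_def mpoly_ring_a_inv)

text \<open>The polynomials all of whose terms are multiples of \<open>A\<close> form an ideal, and each of them is
  the sum of its terms. This turns ideal membership into a condition on exponents.\<close>

lemma Idl_monomials: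
  fixes A :: "('v \<Rightarrow>\<^sub>0 nat) set"
  assumes A: "\<And>a. a \<in> A \<Longrightarrow> Poly_Mapping.keys a \<subseteq> V"
  shows "Idl\<^bsub>mpoly_ring V\<^esub> (monom_of ` A :: ('v, 'k::field) mpoly set)
       = {f \<in> carrier (mpoly_ring V). Poly_Mapping.keys f \<subseteq> multiples A}" (is "?I = ?D")
proof -
  let ?R = "mpoly_ring V :: ('v, 'k) mpoly ring"
  interpret cring "?R" by (rule cring_mpoly_ring)
  have sub: "(monom_of ` A :: ('v, 'k) mpoly set) \<subseteq> carrier ?R"
    using A by (auto simp: mpoly_ring_carrier)
  have mult: "Poly_Mapping.keys (f * g) \<subseteq> multiples A" if "Poly_Mapping.keys f \<subseteq> multiples A"
    for f g :: "('v, 'k) mpoly"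
  proof
    fix k assume "k \<in> Poly_Mapping.keys (f * g)"
    then obtain a b where "a \<in> Poly_Mapping.keys f" "k = a + b" by (rule keys_mult_mpoly)
    thus "k \<in> multiples A" using that multiples_mono[OF _ exp_le_add] by blast
  qed
  have "ideal ?D ?R"
  proof (rule idealI[OF ring_axioms])
    show "subgroup ?D (add_monoid ?R)"
    proof (rule add.subgroupI)
      have "0 \<in> ?D" using zero_closed by simp
      thus "?D \<noteq> {}" by blast
    next
      fix f assume "f \<in> ?D"
      thus "\<ominus>\<^bsub>?R\<^esub> f \<in> ?D"
        using a_inv_closed[of f] by (auto simp: mpoly_ring_a_inv keys_uminus_mpoly)
    next
      fix f g assume "f \<in> ?D" "g \<in> ?D"
      thus "f \<oplus>\<^bsub>?R\<^esub> g \<in> ?D"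
        using keys_add[of f g] a_closed[of f g] by auto
    qed auto
  next
    fix f g assume "f \<in> ?D" "g \<in> carrier ?R"
    thus "g \<otimes>\<^bsub>?R\<^esub> f \<in> ?D" "f \<otimes>\<^bsub>?R\<^esub> g \<in> ?D"
      using mult[of f g] m_closed[of f g] by (auto simp: mult.commute[of g f])
  qed
  moreover have "monom_of ` A \<subseteq> ?D"
    using sub subset_multiples[of A] by auto
  ultimately have "?I \<subseteq> ?D" by (rule genideal_minimal)
  moreover have "?D \<subseteq> ?I"
  proof
    fix f assume f: "f \<in> ?D"
    interpret I: ideal ?I "?R" using sub by (rule genideal_ideal)
    have term_in: "Poly_Mapping.single k c \<in> ?I"
      if k: "k \<in> multiples A" "Poly_Mapping.keys k \<subseteq> V" for k and c :: 'k
    proof -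
      obtain a where a: "a \<in> A" "a \<preceq> k" using k by (auto simp: multiples_def)
      have "Poly_Mapping.keys (k - a) \<subseteq> V"
        using k(2) exp_le_add_diff[OF a(2)] keys_add_exp[of a "k - a"] by simp
      hence "(Poly_Mapping.single (k - a) c :: ('v, 'k) mpoly) \<in> carrier ?R"
        by (simp add: mpoly_ring_carrier)
      moreover have "monom_of a \<in> ?I" using genideal_self[OF sub] a(1) by auto
      ultimately have "Poly_Mapping.single (k - a) c * monom_of a \<in> ?I"
        using I.I_l_closed[of "monom_of a" "Poly_Mapping.single (k - a) c"] by simp
      moreover have "k - a + a = k" using exp_le_add_diff[OF a(2)] by (simp add: add.commute)
      ultimately show ?thesis by (simp add: mult_single)
    qed
    have sum_in: "(\<Sum>k\<in>F. Poly_Mapping.single k (Poly_Mapping.lookup f k)) \<in> ?I"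
      if "F \<subseteq> Poly_Mapping.keys f" for F
      using finite_subset[OF that finite_keys] that
    proof (induction F rule: finite_induct)
      case empty
      show ?case using additive_subgroup.zero_closed[OF I.is_additive_subgroup] by simp
    next
      case (insert k F)
      hence "Poly_Mapping.single k (Poly_Mapping.lookup f k) \<in> ?I"
        using f by (intro term_in) (auto simp: mpoly_ring_carrier)
      from additive_subgroup.a_closed[OF I.is_additive_subgroup this insert.IH] show ?case
        using insert by simp
    qed
    moreover have "(\<Sum>k\<in>Poly_Mapping.keys f. Poly_Mapping.single k (Poly_Mapping.lookup f k)) = f"
      by (intro poly_mapping_eqI) (auto simp: lookup_sum lookup_single when_def in_keys_iff)
    ultimately show "f \<in> ?I" using sum_in[OF order_refl] by simp
  qed
  ultimately show ?thesis by (rule equalityI)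
qed

lemma monom_in_Idl_iff:
  assumes "\<And>a. a \<in> A \<Longrightarrow> Poly_Mapping.keys a \<subseteq> V" "Poly_Mapping.keys k \<subseteq> V"
  shows "monom_of k \<in> Idl\<^bsub>mpoly_ring V\<^esub> (monom_of ` A :: ('v, 'k::field) mpoly set) \<longleftrightarrow> k \<in> multiples A"
  using assms by (simp add: Idl_monomials mpoly_ring_carrier)

lemma inj_monom_of: "inj (monom_of :: ('v \<Rightarrow>\<^sub>0 nat) \<Rightarrow> ('v, 'k::field) mpoly)"
  by (rule injI) (metis keys_single singleton_inject zero_neq_one)

lemma monomials_eq: "monomials V = monom_of ` {a. Poly_Mapping.keys a \<subseteq> V}"
  by (auto simp: monomials_def)

text \<open>The minimal exponents generate, and a generating set of monomials must contain every one of
  them, since no other exponent in the ideal divides a minimal one. So the inclusion-minimal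
  generating set exists and is unique, which is what the description in \<^const>\<open>min_gens\<close> needs.\<close>

lemma min_gens_monomials:
  fixes A :: "('v \<Rightarrow>\<^sub>0 nat) set"
  assumes A: "\<And>a. a \<in> A \<Longrightarrow> Poly_Mapping.keys a \<subseteq> V"
  shows "min_gens V (Idl\<^bsub>mpoly_ring V\<^esub> (monom_of ` A)) = (monom_of ` minimal_exps A :: ('v, 'k::field) mpoly set)"
proof -
  let ?I = "\<lambda>B. Idl\<^bsub>mpoly_ring V\<^esub> (monom_of ` B :: ('v, 'k) mpoly set)"
  have min: "\<And>a. a \<in> minimal_exps A \<Longrightarrow> Poly_Mapping.keys a \<subseteq> V"
    using A by (auto simp: minimal_exps_def)
  have gen: "?I (minimal_exps A) = ?I A"
    using A min by (simp add: Idl_monomials multiples_minimal_exps)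
  show ?thesis
    unfolding min_gens_def
  proof (rule the_equality)
    have "?I B \<noteq> ?I A" if B: "B \<subset> minimal_exps A" for B
    proof
      assume eq: "?I B = ?I A"
      obtain a where a: "a \<in> minimal_exps A" "a \<notin> B" using B by blast
      have "monom_of a \<in> ?I B"
        unfolding eq gen[symmetric] using a(1) min subset_multiples by (subst monom_in_Idl_iff) blast+
      hence "a \<in> multiples B"
        using monom_in_Idl_iff[of B V a] min B a(1) by blast
      then obtain b where "b \<in> B" "b \<preceq> a" by (auto simp: multiples_def)
      thus False using a B by (auto simp: minimal_exps_def)
    qed
    note * = this
    have "Idl\<^bsub>mpoly_ring V\<^esub> H \<noteq> ?I A" if H: "H \<subset> monom_of ` minimal_exps A" for H
    proof -
      obtain B where B: "B \<subseteq> minimal_exps A" "H = monom_of ` B"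
        using H by (auto elim!: subset_imageE dest!: psubset_imp_subset)
      with H have "B \<subset> minimal_exps A" by blast
      thus ?thesis using * B(2) by blast
    qed
    thus "monom_of ` minimal_exps A \<subseteq> monomials V \<and> ?I (minimal_exps A) = ?I A \<and>
        (\<forall>H. H \<subset> monom_of ` minimal_exps A \<longrightarrow> Idl\<^bsub>mpoly_ring V\<^esub> H \<noteq> ?I A)"
      using min gen by (auto simp: monomials_eq)
  next
    fix G :: "('v, 'k) mpoly set"
    assume G: "G \<subseteq> monomials V \<and> Idl\<^bsub>mpoly_ring V\<^esub> G = ?I A \<and> (\<forall>H. H \<subset> G \<longrightarrow> Idl\<^bsub>mpoly_ring V\<^esub> H \<noteq> ?I A)"
    then obtain B where B: "\<And>b. b \<in> B \<Longrightarrow> Poly_Mapping.keys b \<subseteq> V" and GB: "G = monom_of ` B"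
      unfolding monomials_eq by (auto elim!: subset_imageE)
    have same: "k \<in> multiples B \<longleftrightarrow> k \<in> multiples A" if "Poly_Mapping.keys k \<subseteq> V" for k
    proof -
      have "?I B = ?I A" using G GB by simp
      thus ?thesis
        using monom_in_Idl_iff[OF B that, of B, where 'k = 'k] monom_in_Idl_iff[OF A that, of A, where 'k = 'k]
        by simp
    qed
    have "minimal_exps A \<subseteq> B"
    proof
      fix a assume a: "a \<in> minimal_exps A"
      hence aA: "a \<in> A" by (simp add: minimal_exps_def)
      hence "a \<in> multiples B" using same[OF A[OF aA]] subset_multiples by blast
      then obtain b where b: "b \<in> B" "b \<preceq> a" by (auto simp: multiples_def)
      hence "b \<in> multiples A" using same[OF B[OF b(1)]] subset_multiples by blast
      then obtain a' where a': "a' \<in> A" "a' \<preceq> b" by (auto simp: multiples_def)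
      have "a' \<preceq> a" using a'(2) b(2) by (rule exp_le_trans)
      hence "a' = a" using a a'(1) by (auto simp: minimal_exps_def)
      thus "a \<in> B" using a' b exp_le_antisym by blast
    qed
    hence "monom_of ` minimal_exps A \<subseteq> G" unfolding GB by (rule image_mono)
    moreover have "\<not> monom_of ` minimal_exps A \<subset> G" using G gen by blast
    ultimately show "G = monom_of ` minimal_exps A" by blast
  qed
qed

section \<open>Depth of monomial quotients in three variables\<close>

definition xyz_exp :: "nat \<Rightarrow> nat \<Rightarrow> nat \<Rightarrow> (xyz \<Rightarrow>\<^sub>0 nat)" where
  "xyz_exp a b c = Poly_Mapping.single VX a + Poly_Mapping.single VY b + Poly_Mapping.single VZ c"

lemma lookup_xyz_exp [simp]:
  "Poly_Mapping.lookup (xyz_exp a b c) VX = a"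
  "Poly_Mapping.lookup (xyz_exp a b c) VY = b"
  "Poly_Mapping.lookup (xyz_exp a b c) VZ = c"
  by (simp_all add: xyz_exp_def lookup_add lookup_single)

lemma all_xyz: "(\<forall>v. P v) \<longleftrightarrow> P VX \<and> P VY \<and> P VZ"
  by (metis xyz.exhaust)

lemma xyz_exp_le_iff:
  "k \<preceq> l \<longleftrightarrow> Poly_Mapping.lookup k VX \<le> Poly_Mapping.lookup l VX
      \<and> Poly_Mapping.lookup k VY \<le> Poly_Mapping.lookup l VY
      \<and> Poly_Mapping.lookup k VZ \<le> Poly_Mapping.lookup l VZ"
  unfolding exp_le_def all_xyz ..

lemma xyz_exp_eqI:
  assumes "Poly_Mapping.lookup k VX = Poly_Mapping.lookup l VX"
    "Poly_Mapping.lookup k VY = Poly_Mapping.lookup l VY"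
    "Poly_Mapping.lookup k VZ = Poly_Mapping.lookup l VZ"
  shows "k = l"
proof (rule poly_mapping_eqI)
  show "Poly_Mapping.lookup k v = Poly_Mapping.lookup l v" for v using assms by (cases v) auto
qed

lemma UNIV_xyz: "{VX, VY, VZ} = UNIV"
  using xyz.exhaust by blast

lemma carrier_Kxyz [simp]: "f \<in> carrier Kxyz"
  by (simp add: mpoly_ring_carrier UNIV_xyz)

lemma mem_Idl_Kxyz:
  "f \<in> Idl\<^bsub>Kxyz\<^esub> (monom_of ` X :: (xyz, 'k::field) mpoly set) \<longleftrightarrow> Poly_Mapping.keys f \<subseteq> multiples X"
  by (subst Idl_monomials) (simp_all add: UNIV_xyz mpoly_ring_carrier)

lemma single_le_iff: "Poly_Mapping.single v (1::nat) \<preceq> k \<longleftrightarrow> Poly_Mapping.lookup k v \<noteq> 0"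
  by (auto simp: exp_le_def lookup_single when_def)

lemma lookup_mvar_mult:
  "Poly_Mapping.lookup (mvar v * f) k =
    (if Poly_Mapping.lookup k v = 0 then 0 else Poly_Mapping.lookup f (k - Poly_Mapping.single v 1))"
  by (simp add: mvar_def lookup_monom_mult single_le_iff del: One_nat_def)

text \<open>
  The coefficient of \<open>(\<Sum>w. w) f\<close> at \<open>m v\<close> is the sum of the coefficients of \<open>f\<close> at the monomials
  \<open>m v / w\<close>. Those in the ideal would put \<open>m v\<close> there as well, and by extremality those outside do
  not occur in \<open>f\<close>; so only the coefficient of \<open>m\<close> is left and \<open>m v\<close> occurs in the product.
\<close>

lemma next_multiple_in_ideal:
  fixes f :: "('v, 'k::field) mpoly"
  assumes W: "finite W" "v \<in> W"
    and prod: "Poly_Mapping.keys ((\<Sum>w\<in>W. mvar w) * f) \<subseteq> multiples X"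
    and m: "m \<in> Poly_Mapping.keys f"
    and extremal: "\<And>w k. \<lbrakk>w \<in> W; w \<noteq> v; k \<in> Poly_Mapping.keys f - multiples X\<rbrakk> \<Longrightarrow>
        m + Poly_Mapping.single v 1 \<noteq> k + Poly_Mapping.single w 1"
  shows "m + Poly_Mapping.single v 1 \<in> multiples X"
proof (rule ccontr)
  let ?e = "\<lambda>w. Poly_Mapping.single w (1::nat)"
  assume out: "m + ?e v \<notin> multiples X"
  have other: "Poly_Mapping.lookup (mvar w * f) (m + ?e v) = 0" if w: "w \<in> W" "w \<noteq> v" for w
  proof (rule ccontr)
    assume "Poly_Mapping.lookup (mvar w * f) (m + ?e v) \<noteq> 0"
    hence "?e w \<preceq> m + ?e v" and k: "m + ?e v - ?e w \<in> Poly_Mapping.keys f"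
      unfolding lookup_mvar_mult single_le_iff by (auto simp: in_keys_iff split: if_splits)
    hence eq: "m + ?e v = (m + ?e v - ?e w) + ?e w"
      using exp_le_add_diff[of "?e w" "m + ?e v"] by (simp add: add.commute)
    hence "m + ?e v - ?e w \<notin> multiples X"
      using multiples_mono[OF _ exp_le_add, of "m + ?e v - ?e w" X "?e w"] out by auto
    thus False using extremal[OF w, of "m + ?e v - ?e w"] k eq by blast
  qed
  have "Poly_Mapping.lookup ((\<Sum>w\<in>W. mvar w) * f) (m + ?e v)
      = (\<Sum>w\<in>W. Poly_Mapping.lookup (mvar w * f) (m + ?e v))"
    by (simp add: sum_distrib_right lookup_sum)
  also have "\<dots> = Poly_Mapping.lookup (mvar v * f) (m + ?e v)"
    using W other by (subst sum.remove[of _ v]) auto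
  also have "\<dots> = Poly_Mapping.lookup f m"
    by (simp add: lookup_mvar_mult lookup_add)
  also have "\<dots> \<noteq> 0" using m by (simp add: in_keys_iff)
  finally have "m + ?e v \<in> Poly_Mapping.keys ((\<Sum>w\<in>W. mvar w) * f)"
    by (simp add: in_keys_iff)
  thus False using prod out by blast
qed

text \<open>
  The terms of \<open>f\<close> outside the ideal form a finite set \<open>F\<close>. If \<open>F\<close> reaches the range where the
  ideal is constant in \<open>x\<close>, a term of largest \<open>x\<close>-degree may be multiplied by \<open>x\<close>. Otherwise only
  terms of least \<open>x\<close>-degree matter: they lie in one slice \<open>(y\<^sup>B z\<^sup>C)\<close>, each having too small an
  exponent in \<open>y\<close> or in \<open>z\<close>. A term with the least \<open>y\<close>-exponent, if that is below \<open>B\<close>, may be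
  multiplied by \<open>z\<close>, which leaves the \<open>y\<close>-exponent too small; the case of \<open>z\<close> is symmetric.
\<close>

lemma sum_of_variables_nonzerodivisor:
  notes One_nat_def [simp del]
  fixes f :: "(xyz, 'k::field) mpoly"
  assumes stable: "\<And>k. \<lbrakk>n \<le> Poly_Mapping.lookup k VX; k + Poly_Mapping.single VX 1 \<in> multiples X\<rbrakk> \<Longrightarrow>
        k \<in> multiples X"
    and slice: "\<And>a. a < n \<Longrightarrow> \<exists>B C. \<forall>k. Poly_Mapping.lookup k VX = a \<longrightarrow>
        (k \<in> multiples X \<longleftrightarrow> B \<le> Poly_Mapping.lookup k VY \<and> C \<le> Poly_Mapping.lookup k VZ)"
    and prod: "Poly_Mapping.keys ((\<Sum>v\<in>{VX, VY, VZ}. mvar v) * f) \<subseteq> multiples X"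
  shows "Poly_Mapping.keys f \<subseteq> multiples X"
proof (rule ccontr)
  let ?x = "\<lambda>k. Poly_Mapping.lookup k VX"
  let ?y = "\<lambda>k. Poly_Mapping.lookup k VY"
  let ?z = "\<lambda>k. Poly_Mapping.lookup k VZ"
  let ?e = "\<lambda>w. Poly_Mapping.single w (1::nat)"
  let ?W = "{VX, VY, VZ}"
  define F where "F = Poly_Mapping.keys f - multiples X"
  assume "\<not> ?thesis"
  then obtain m0 where m0: "m0 \<in> F" by (auto simp: F_def)
  have step: "m + ?e v \<in> multiples X"
    if "m \<in> F" "\<And>w k. w \<noteq> v \<Longrightarrow> k \<in> F \<Longrightarrow> m + ?e v \<noteq> k + ?e w" for m v
    using next_multiple_in_ideal[of ?W v f X m] that prod xyz.exhaust unfolding F_def by blast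
  have fin: "finite F" by (simp add: F_def)
  have x_shift: "?x (m + ?e w) = (if w = VX then ?x m + 1 else ?x m)"
    "?y (m + ?e w) = (if w = VY then ?y m + 1 else ?y m)"
    "?z (m + ?e w) = (if w = VZ then ?z m + 1 else ?z m)" for m w
    by (auto simp: lookup_add lookup_single)
  show False
  proof (cases "\<exists>k\<in>F. n \<le> ?x k")
    case True
    have "Max (?x ` F) \<in> ?x ` F" using fin m0 by (intro Max_in) auto
    then obtain m where m: "m \<in> F" "?x m = Max (?x ` F)" by auto
    hence max: "?x k \<le> ?x m" if "k \<in> F" for k using fin that by auto
    have "m + ?e VX \<in> multiples X"
    proof (rule step[OF m(1)])
      fix w k assume "w \<noteq> VX" "k \<in> F"
      hence "?x (m + ?e VX) \<noteq> ?x (k + ?e w)" using max[of k] by (simp add: x_shift)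
      thus "m + ?e VX \<noteq> k + ?e w" by metis
    qed
    hence "m \<in> multiples X" using stable True max order_trans by blast
    thus False using m(1) by (simp add: F_def)
  next
    case False
    obtain m1 where m1: "m1 \<in> F" and min_x: "\<And>k. k \<in> F \<Longrightarrow> ?x m1 \<le> ?x k"
      using ex_has_least_nat[of "\<lambda>k. k \<in> F" m0 ?x] m0 by metis
    obtain B C where BC: "\<And>k. ?x k = ?x m1 \<Longrightarrow> k \<in> multiples X \<longleftrightarrow> B \<le> ?y k \<and> C \<le> ?z k"
      using slice[of "?x m1"] False m1 by (metis not_le)
    define Fa where "Fa = {k \<in> F. ?x k = ?x m1}"
    have Fa: "Fa \<subseteq> F" "m1 \<in> Fa" using m1 by (auto simp: Fa_def)
    have out: "\<not> (B \<le> ?y k \<and> C \<le> ?z k)" if "k \<in> Fa" for k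
      using that BC[of k] by (auto simp: Fa_def F_def)
    show False
    proof (cases "\<exists>k\<in>Fa. ?y k < B")
      case True
      then obtain m2 where m2: "m2 \<in> Fa" "?y m2 < B" by blast
      obtain m where m: "m \<in> Fa" and min_y: "\<And>k. k \<in> Fa \<Longrightarrow> ?y m \<le> ?y k"
        using ex_has_least_nat[of "\<lambda>k. k \<in> Fa" m2 ?y] m2(1) by metis
      have "m + ?e VZ \<in> multiples X"
      proof (rule step)
        show "m \<in> F" using m Fa by blast
        fix w k assume w: "w \<noteq> VZ" and k: "k \<in> F"
        show "m + ?e VZ \<noteq> k + ?e w"
        proof
          assume eq: "m + ?e VZ = k + ?e w"
          have mx: "?x m = ?x m1" using m by (simp add: Fa_def)
          show False
          proof (cases w)
            case VX
            thus False using arg_cong[OF eq, of ?x] min_x[OF k] mx by (simp add: x_shift)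
          next
            case VY
            hence "k \<in> Fa" using arg_cong[OF eq, of ?x] k mx by (simp add: x_shift Fa_def)
            thus False using VY arg_cong[OF eq, of ?y] min_y by (fastforce simp: x_shift)
          qed (use w in simp)
        qed
      qed
      hence "B \<le> ?y m" using BC[of "m + ?e VZ"] m by (simp add: x_shift Fa_def)
      thus False using min_y[OF m2(1)] m2(2) by simp
    next
      case False
      obtain m where m: "m \<in> Fa" and min_z: "\<And>k. k \<in> Fa \<Longrightarrow> ?z m \<le> ?z k"
        using ex_has_least_nat[of "\<lambda>k. k \<in> Fa" m1 ?z] Fa(2) by metis
      have "m + ?e VY \<in> multiples X"
      proof (rule step)
        show "m \<in> F" using m Fa by blast
        fix w k assume w: "w \<noteq> VY" and k: "k \<in> F"
        show "m + ?e VY \<noteq> k + ?e w"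
        proof
          assume eq: "m + ?e VY = k + ?e w"
          have mx: "?x m = ?x m1" using m by (simp add: Fa_def)
          show False
          proof (cases w)
            case VX
            thus False using arg_cong[OF eq, of ?x] min_x[OF k] mx by (simp add: x_shift)
          next
            case VZ
            hence "k \<in> Fa" using arg_cong[OF eq, of ?x] k mx by (simp add: x_shift Fa_def)
            thus False using VZ arg_cong[OF eq, of ?z] min_z by (fastforce simp: x_shift)
          qed (use w in simp)
        qed
      qed
      hence "C \<le> ?z m" using BC[of "m + ?e VY"] m by (simp add: x_shift Fa_def)
      thus False using False m out[OF m] by auto
    qed
  qed
qed

lemma quotient_module_Kxyz:
  "quotient_module Kxyz (Idl\<^bsub>Kxyz\<^esub> (monom_of ` X :: (xyz, 'k::field) mpoly set))"
proof -
  interpret cring "Kxyz :: (xyz, 'k) mpoly ring" by (rule cring_mpoly_ring)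
  show ?thesis
    by (intro quotient_module.intro is_cring genideal_ideal) auto
qed

lemma Kxyz_minus: "f \<ominus>\<^bsub>Kxyz\<^esub> g = f - g"
  by (intro mpoly_ring_minus carrier_Kxyz)

text \<open>
  The witness for \<open>depth_quot_le_one\<close> is \<open>x\<^sup>k y\<^sup>b z\<^sup>c\<close> with the least \<open>k\<close> for which it is killed by
  \<open>y\<close> and \<open>z\<close>. If it were \<open>x m\<close> modulo the ideal with \<open>m\<close> killed by \<open>y\<close> and \<open>z\<close>, then
  \<open>x\<^bsup>k-1\<^esup> y\<^sup>b z\<^sup>c\<close> would be a term of \<open>m\<close>, and, the ideal being monomial, it would be killed as well.
\<close>

lemma depth_le_one_if_corner:
  notes One_nat_def [simp del]
  fixes X :: "(xyz \<Rightarrow>\<^sub>0 nat) set"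
  assumes out: "xyz_exp n b c \<notin> multiples X"
    and "xyz_exp n (Suc b) c \<in> multiples X" "xyz_exp n b (Suc c) \<in> multiples X"
  shows "depth Kxyz max_ideal_xyz
      (quot_module Kxyz (Idl\<^bsub>Kxyz\<^esub> (monom_of ` X :: (xyz, 'k::field) mpoly set))) \<le> 1"
proof -
  let ?I = "Idl\<^bsub>Kxyz\<^esub> (monom_of ` X :: (xyz, 'k) mpoly set)"
  interpret quotient_module "Kxyz :: (xyz, 'k) mpoly ring" ?I by (rule quotient_module_Kxyz)
  define P where "P k \<longleftrightarrow> xyz_exp k (Suc b) c \<in> multiples X \<and> xyz_exp k b (Suc c) \<in> multiples X" for k
  define k where "k = (LEAST k. P k)"
  have "P n" using assms by (simp add: P_def)
  hence k: "P k" "k \<le> n" unfolding k_def by (auto intro: LeastI Least_le)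
  have least: "\<not> P l" if "l < k" for l using that not_less_Least unfolding k_def by blast
  have shift: "Poly_Mapping.single VY 1 + xyz_exp l b c = xyz_exp l (Suc b) c"
    "Poly_Mapping.single VZ 1 + xyz_exp l b c = xyz_exp l b (Suc c)" for l
    by (rule xyz_exp_eqI; simp add: lookup_add lookup_single)+
  have k_out: "xyz_exp k b c \<notin> multiples X"
    using out k(2) multiples_mono[of "xyz_exp k b c" X "xyz_exp n b c"] by (auto simp: xyz_exp_le_iff)
  show ?thesis
  proof (rule depth_quot_le_one[where x = "mvar VX" and Q = "{mvar VY, mvar VZ}"
        and c = "monom_of (xyz_exp k b c)"])
    fix q :: "(xyz, 'k) mpoly" assume "q \<in> {mvar VY, mvar VZ}"
    thus "q \<otimes>\<^bsub>Kxyz\<^esub> monom_of (xyz_exp k b c) \<in> ?I"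
      using k(1) by (auto simp: mem_Idl_Kxyz mvar_def mult_single shift P_def)
  next
    fix m :: "(xyz, 'k) mpoly"
    assume m: "\<And>q. q \<in> {mvar VY, mvar VZ} \<Longrightarrow> q \<otimes>\<^bsub>Kxyz\<^esub> m \<in> ?I"
    show "monom_of (xyz_exp k b c) \<ominus>\<^bsub>Kxyz\<^esub> mvar VX \<otimes>\<^bsub>Kxyz\<^esub> m \<notin> ?I"
    proof
      assume "monom_of (xyz_exp k b c) \<ominus>\<^bsub>Kxyz\<^esub> mvar VX \<otimes>\<^bsub>Kxyz\<^esub> m \<in> ?I"
      hence "Poly_Mapping.lookup (monom_of (xyz_exp k b c) - mvar VX * m) (xyz_exp k b c) = 0"
        using k_out by (auto simp: Kxyz_minus mem_Idl_Kxyz in_keys_iff)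
      hence "Poly_Mapping.lookup (mvar VX * m) (xyz_exp k b c) \<noteq> 0"
        by (simp add: lookup_minus)
      hence "k \<noteq> 0" and mem: "xyz_exp k b c - Poly_Mapping.single VX 1 \<in> Poly_Mapping.keys m"
        by (auto simp: lookup_mvar_mult in_keys_iff split: if_splits)
      moreover have "xyz_exp k b c - Poly_Mapping.single VX 1 = xyz_exp (k - 1) b c"
        by (rule xyz_exp_eqI) (simp_all add: lookup_minus lookup_single)
      ultimately have mem: "xyz_exp (k - 1) b c \<in> Poly_Mapping.keys m" by simp
      have "Poly_Mapping.single v 1 + xyz_exp (k - 1) b c \<in> multiples X" if "v = VY \<or> v = VZ" for v
      proof -
        have "mvar v * m \<in> ?I" using m[of "mvar v"] that by auto
        moreover have "Poly_Mapping.single v 1 + xyz_exp (k - 1) b c \<in> Poly_Mapping.keys (mvar v * m)"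
          using mem by (simp add: mvar_def keys_monom_mult)
        ultimately show ?thesis by (auto simp: mem_Idl_Kxyz)
      qed
      hence "P (k - 1)" unfolding P_def by (metis shift)
      thus False using least[of "k - 1"] \<open>k \<noteq> 0\<close> by simp
    qed
  qed auto
qed

lemma one_le_depth_if_slices:
  fixes X :: "(xyz \<Rightarrow>\<^sub>0 nat) set"
  assumes proper: "0 \<notin> multiples X"
    and stable: "\<And>k. \<lbrakk>n \<le> Poly_Mapping.lookup k VX; k + Poly_Mapping.single VX 1 \<in> multiples X\<rbrakk> \<Longrightarrow>
        k \<in> multiples X"
    and slice: "\<And>a. a < n \<Longrightarrow> \<exists>B C. \<forall>k. Poly_Mapping.lookup k VX = a \<longrightarrow>
        (k \<in> multiples X \<longleftrightarrow> B \<le> Poly_Mapping.lookup k VY \<and> C \<le> Poly_Mapping.lookup k VZ)"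
  shows "1 \<le> depth Kxyz max_ideal_xyz
      (quot_module Kxyz (Idl\<^bsub>Kxyz\<^esub> (monom_of ` X :: (xyz, 'k::field) mpoly set)))"
proof -
  let ?I = "Idl\<^bsub>Kxyz\<^esub> (monom_of ` X :: (xyz, 'k) mpoly set)"
  let ?s = "\<Sum>v\<in>{VX, VY, VZ}. mvar v :: (xyz, 'k) mpoly"
  interpret quotient_module "Kxyz :: (xyz, 'k) mpoly ring" ?I by (rule quotient_module_Kxyz)
  let ?V = "(\<lambda>v. Poly_Mapping.single v (1::nat)) ` {VX, VY, VZ}"
  have \<mm>: "max_ideal_xyz = Idl\<^bsub>Kxyz\<^esub> (monom_of ` ?V :: (xyz, 'k) mpoly set)"
    by (simp add: mvar_def)
  show ?thesis
  proof (rule one_le_depth_quot)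
    have "Poly_Mapping.keys ?s \<subseteq> (\<Union>v\<in>{VX, VY, VZ}. Poly_Mapping.keys (mvar v :: (xyz, 'k) mpoly))"
      by (auto simp: in_keys_iff lookup_sum lookup_add)
    also have "\<dots> \<subseteq> ?V" by (auto simp: mvar_def)
    also have "\<dots> \<subseteq> multiples ?V" by (rule subset_multiples)
    finally show "?s \<in> max_ideal_xyz" unfolding \<mm> mem_Idl_Kxyz .
  next
    show "g \<in> ?I" if "?s \<otimes>\<^bsub>Kxyz\<^esub> g \<in> ?I" for g
      using sum_of_variables_nonzerodivisor[OF stable slice] that
      unfolding mem_Idl_Kxyz mpoly_ring_simps by blast
  next
    fix r :: "(xyz, 'k) mpoly"
    have "Poly_Mapping.lookup (1 - ?s * r) 0 = 1"
      by (simp add: lookup_minus lookup_add distrib_right lookup_mvar_mult)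
    hence "0 \<in> Poly_Mapping.keys (1 - ?s * r)" by (simp add: in_keys_iff)
    thus "\<one>\<^bsub>Kxyz\<^esub> \<ominus>\<^bsub>Kxyz\<^esub> ?s \<otimes>\<^bsub>Kxyz\<^esub> r \<notin> ?I"
      using proper by (auto simp: Kxyz_minus mem_Idl_Kxyz)
  qed auto
qed

text \<open>
  In column \<open>B - 1\<close> the upward closed set \<open>T\<close> starts at a height \<open>d\<close> above \<open>C\<close>, whereas column
  \<open>B\<close> already belongs to it from height \<open>C\<close> on. So \<open>(B - 1, d - 1)\<close> is a corner. The point
  \<open>(b', c')\<close> ensures that column \<open>B - 1\<close> meets \<open>T\<close>.
\<close>

lemma staircase_corner:
  fixes T :: "nat \<Rightarrow> nat \<Rightarrow> bool"
  assumes up: "\<And>b c b' c'. \<lbrakk>T b c; b \<le> b'; c \<le> c'\<rbrakk> \<Longrightarrow> T b' c'"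
    and BC: "T B C" "\<not> T (B - 1) C" and v: "T b' c'" "b' < B"
  shows "\<exists>b c. \<not> T b c \<and> T (Suc b) c \<and> T b (Suc c)"
proof -
  define d where "d = (LEAST d. T (B - 1) d)"
  have "T (B - 1) c'" using up[OF v(1)] v(2) by simp
  hence d: "T (B - 1) d" unfolding d_def by (rule LeastI)
  have "C < d" using up[OF d order_refl, of C] BC(2) by (meson not_le)
  hence "\<not> T (B - 1) (d - 1)" unfolding d_def by (intro not_less_Least) simp
  moreover have "T (Suc (B - 1)) (d - 1)"
    using up[OF BC(1), of B "d - 1"] \<open>C < d\<close> v(2) by simp
  moreover have "T (B - 1) (Suc (d - 1))" using d \<open>C < d\<close> by simp
  ultimately show ?thesis by blast
qed

section \<open>The ideal built from a chain of monomials\<close>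

lemma mvar_pow: "(mvar v :: ('v, 'k::field) mpoly) [^]\<^bsub>mpoly_ring V\<^esub> (n::nat) = monom_of (Poly_Mapping.single v n)"
proof -
  interpret cring "mpoly_ring V :: ('v, 'k) mpoly ring" by (rule cring_mpoly_ring)
  show ?thesis
    by (induction n) (simp_all add: mvar_def mult_single single_add[symmetric])
qed

lemma xpow_ext_monomials:
  assumes "\<And>a. a \<in> A \<Longrightarrow> Poly_Mapping.keys a \<subseteq> {VY, VZ}"
  shows "xpow_ext n (Idl\<^bsub>Kyz\<^esub> (monom_of ` A)) =
    Idl\<^bsub>Kxyz\<^esub> (monom_of ` (+) (Poly_Mapping.single VX n) ` minimal_exps A :: (xyz, 'k::field) mpoly set)"
  using assms by (simp add: xpow_ext_def min_gens_monomials image_image mvar_pow mult_single)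

lemma exp_le_if_divides:
  assumes "monom_of a divides\<^bsub>mpoly_ring V\<^esub> (monom_of b :: ('v, 'k::field) mpoly)"
  shows "a \<preceq> b"
proof -
  obtain h where h: "(monom_of b :: ('v, 'k) mpoly) = monom_of a * h"
    using assms by (auto simp: factor_def)
  have "b \<in> Poly_Mapping.keys (monom_of b :: ('v, 'k) mpoly)" by simp
  thus ?thesis unfolding h keys_monom_mult by (auto intro: exp_le_add)
qed

theorem corollary3p17:
  fixes p :: nat
    and i :: "nat \<Rightarrow> nat"
    and u :: "nat \<Rightarrow> (xyz, 'k::field) mpoly"
    and J :: "nat \<Rightarrow> (xyz, 'k) mpoly set"
    and I :: "(xyz, 'k) mpoly set"
  assumes "p \<ge> 1"
    and "i 0 = 0"
    and "\<forall>j<p. i j < i (Suc j)"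
    and "\<forall>j<p. u j \<in> monomials {VY, VZ}"
    and "\<forall>j. Suc j < p \<longrightarrow> u (Suc j) divides\<^bsub>Kyz\<^esub> u j \<and> u (Suc j) \<noteq> u j"
    and "\<forall>j<p. J j = Idl\<^bsub>Kyz\<^esub> {u j}"
    and "monomial_ideal {VY, VZ} (J p)"
    and "J p \<noteq> carrier Kyz"
    and "J p \<noteq> {\<zero>\<^bsub>Kyz\<^esub>}"
    and "u (p - 1) \<notin> J p"
    and "I = xpow_ext (i p) (J p) <+>\<^bsub>Kxyz\<^esub>
           Idl\<^bsub>Kxyz\<^esub> ((\<lambda>j. mvar VX [^]\<^bsub>Kxyz\<^esub> i j \<otimes>\<^bsub>Kxyz\<^esub> u j) ` {..<p})"
    and "min_gens {VX, VY, VZ} I = (\<Union>j\<in>{..p}. min_gens {VX, VY, VZ} (xpow_ext (i j) (J j)))"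
  shows "depth Kxyz max_ideal_xyz (quot_module Kxyz I) = 1"
proof -
  let ?x = "\<lambda>k. Poly_Mapping.lookup k VX"
  let ?y = "\<lambda>k. Poly_Mapping.lookup k VY"
  let ?z = "\<lambda>k. Poly_Mapping.lookup k VZ"
  let ?sh = "\<lambda>n. (+) (Poly_Mapping.single VX n)"
  interpret R: cring "Kxyz :: (xyz, 'k) mpoly ring" by (rule cring_mpoly_ring)
  have x0: "?x a = 0" if "Poly_Mapping.keys a \<subseteq> {VY, VZ}" for a
    using that by (auto simp: in_keys_iff)
  have "\<forall>j. \<exists>a. j < p \<longrightarrow> u j = monom_of a \<and> Poly_Mapping.keys a \<subseteq> {VY, VZ}"
    using assms(4) by (auto simp: monomials_eq)
  then obtain e where e: "\<And>j. j < p \<Longrightarrow> u j = monom_of (e j)"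
    "\<And>j. j < p \<Longrightarrow> Poly_Mapping.keys (e j) \<subseteq> {VY, VZ}" by metis
  obtain A where A: "\<And>a. a \<in> A \<Longrightarrow> Poly_Mapping.keys a \<subseteq> {VY, VZ}"
    and JA: "J p = Idl\<^bsub>Kyz\<^esub> (monom_of ` A)"
    using assms(7) unfolding monomial_ideal_def monomials_eq by (auto elim!: subset_imageE)
  define M where "M = minimal_exps A"
  have M: "Poly_Mapping.keys a \<subseteq> {VY, VZ}" if "a \<in> M" for a
    using that A by (simp add: M_def minimal_exps_def)
  define X where "X = ?sh (i p) ` M \<union> (\<lambda>j. ?sh (i j) (e j)) ` {..<p}"
  have xpow: "xpow_ext (i p) (J p) = Idl\<^bsub>Kxyz\<^esub> (monom_of ` ?sh (i p) ` M)"
    unfolding JA M_def using A by (rule xpow_ext_monomials)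
  have I: "I = Idl\<^bsub>Kxyz\<^esub> (monom_of ` X)"
  proof -
    have "(\<lambda>j. mvar VX [^]\<^bsub>Kxyz\<^esub> i j \<otimes>\<^bsub>Kxyz\<^esub> u j) ` {..<p} = monom_of ` (\<lambda>j. ?sh (i j) (e j)) ` {..<p}"
      unfolding image_image by (intro image_cong) (simp_all add: e mvar_pow mult_single)
    thus ?thesis
      unfolding assms(11) xpow X_def image_Un by (subst R.genideal_Un) auto
  qed

  have e_step: "e (Suc j) \<preceq> e j" if "Suc j < p" for j
  proof -
    have "u (Suc j) divides\<^bsub>Kyz\<^esub> u j" using assms(5) that by blast
    thus ?thesis
      using e(1)[of j] e(1)[of "Suc j"] that exp_le_if_divides by auto
  qed
  have e_anti: "e l \<preceq> e j" if "j \<le> l" "l < p" for j l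
    using that
  proof (induction l rule: dec_induct)
    case base show ?case by (rule exp_le_refl)
  next
    case (step l) thus ?case using e_step[of l] exp_le_trans by auto
  qed
  have i_mono: "i j < i l" if "j < l" "l \<le> p" for j l
    using that
  proof (induction l)
    case (Suc l)
    have "i l < i (Suc l)" using assms(3) Suc.prems by auto
    moreover have "i j \<le> i l" using Suc by (cases "j = l") auto
    ultimately show ?case by simp
  qed simp

  define S where "S b c \<longleftrightarrow> (\<exists>a\<in>M. ?y a \<le> b \<and> ?z a \<le> c)" for b c
  have S_up: "S b' c'" if "S b c" "b \<le> b'" "c \<le> c'" for b c b' c'
    using that order_trans unfolding S_def by blast
  have mem_X: "k \<in> multiples X \<longleftrightarrow>
      i p \<le> ?x k \<and> S (?y k) (?z k) \<or> (\<exists>j<p. i j \<le> ?x k \<and> ?y (e j) \<le> ?y k \<and> ?z (e j) \<le> ?z k)" for k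
  proof -
    have "?sh n a \<preceq> k \<longleftrightarrow> n \<le> ?x k \<and> ?y a \<le> ?y k \<and> ?z a \<le> ?z k"
      if "Poly_Mapping.keys a \<subseteq> {VY, VZ}" for n a
      using x0[OF that] by (simp add: xyz_exp_le_iff lookup_add lookup_single)
    thus ?thesis
      using M e(2) unfolding X_def multiples_Un S_def by (auto simp: multiples_def)
  qed

  define q where "q = p - 1"
  have q: "q < p" "Suc q = p" using assms(1) by (auto simp: q_def)
  have eq_least: "e q \<preceq> e j" if "j < p" for j using e_anti[of j q] that q by simp
  have not_S: "\<not> S (?y (e q)) (?z (e q))"
  proof
    assume "S (?y (e q)) (?z (e q))"
    then obtain a where a: "a \<in> M" "?y a \<le> ?y (e q)" "?z a \<le> ?z (e q)" by (auto simp: S_def)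
    hence "a \<preceq> e q" using x0[OF M[OF a(1)]] by (simp add: xyz_exp_le_iff)
    hence "e q \<in> multiples A" using a(1) by (auto simp: M_def minimal_exps_def multiples_def)
    hence "u q \<in> J p" unfolding JA e(1)[OF q(1)] using A e(2)[OF q(1)] by (subst monom_in_Idl_iff) auto
    thus False using assms(10) by (simp add: q_def)
  qed
  \<comment> \<open>If \<open>u\<^bsub>p-1\<^esub>\<close> divided \<open>v\<close>, then \<open>x\<^sup>n v\<close> with \<open>n = i\<^sub>p\<close> would be a proper multiple of another generator
    of \<open>I\<close>, although it is one of the minimal generators.\<close>
  obtain v where v: "v \<in> M" "\<not> e q \<preceq> v"
  proof -
    have "A \<noteq> {}"
    proof
      assume "A = {}"
      hence "J p = {0}"
        unfolding JA using A
        by (subst Idl_monomials) (auto simp: multiples_def mpoly_ring_carrier)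
      thus False using assms(9) by simp
    qed
    then obtain k where "k \<in> multiples A" using subset_multiples by blast
    hence "k \<in> multiples M" by (simp add: M_def multiples_minimal_exps)
    then obtain a where "a \<in> M" by (auto simp: multiples_def)
    hence "?sh (i p) a \<in> multiples (minimal_exps (?sh (i p) ` M))"
      unfolding multiples_minimal_exps using subset_multiples by blast
    then obtain w where w: "w \<in> minimal_exps (?sh (i p) ` M)" by (auto simp: multiples_def)
    then obtain v where v: "v \<in> M" "w = ?sh (i p) v" by (auto simp: minimal_exps_def)
    have "(monom_of w :: (xyz, 'k) mpoly) \<in> min_gens {VX, VY, VZ} (xpow_ext (i p) (J p))"
      unfolding xpow using w by (subst min_gens_monomials) (auto simp: UNIV_xyz)
    hence "(monom_of w :: (xyz, 'k) mpoly) \<in> min_gens {VX, VY, VZ} I"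
      unfolding assms(12) by blast
    hence "(monom_of w :: (xyz, 'k) mpoly) \<in> monom_of ` minimal_exps X"
      unfolding I by (subst (asm) min_gens_monomials) (auto simp: UNIV_xyz)
    hence wX: "w \<in> minimal_exps X" by (simp add: inj_image_mem_iff[OF inj_monom_of])
    have "\<not> e q \<preceq> v"
    proof
      assume "e q \<preceq> v"
      hence "?sh (i q) (e q) \<preceq> w"
        using i_mono[of q p] q by (auto simp: v(2) xyz_exp_le_iff lookup_add lookup_single)
      moreover have "?sh (i q) (e q) \<in> X" using q by (auto simp: X_def)
      ultimately have "?sh (i q) (e q) = w" using wX by (auto simp: minimal_exps_def)
      hence "?x (?sh (i q) (e q)) = ?x (?sh (i p) v)" by (simp add: v(2))
      hence "i q = i p"
        using x0[OF e(2)[OF q(1)]] x0[OF M[OF v(1)]] by (simp add: lookup_add lookup_single)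
      thus False using i_mono[of q p] q by simp
    qed
    thus thesis using that v(1) by blast
  qed

  \<comment> \<open>The slice of \<open>I\<close> in \<open>x\<close>-degree \<open>i\<^sub>p\<close>. Neither \<open>u\<^bsub>p-1\<^esub>\<close> nor \<open>v\<close> divides the other, so \<open>v\<close> is
    strictly smaller in one of the two exponents.\<close>
  define T where "T b c \<longleftrightarrow> xyz_exp (i p) b c \<in> multiples X" for b c
  have T_iff: "T b c \<longleftrightarrow> S b c \<or> ?y (e q) \<le> b \<and> ?z (e q) \<le> c" for b c
  proof -
    have "?y (e q) \<le> b \<and> ?z (e q) \<le> c" if "j < p" "?y (e j) \<le> b" "?z (e j) \<le> c" for j
      using eq_least[OF that(1)] that(2,3) by (simp add: xyz_exp_le_iff)
    moreover have "i q \<le> i p" using i_mono[of q p] q by simp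
    ultimately have "(\<exists>j<p. i j \<le> i p \<and> ?y (e j) \<le> b \<and> ?z (e j) \<le> c) \<longleftrightarrow> ?y (e q) \<le> b \<and> ?z (e q) \<le> c"
      using q(1) by blast
    thus ?thesis by (simp add: T_def mem_X)
  qed
  have T_up: "T b' c'" if "T b c" "b \<le> b'" "c \<le> c'" for b c b' c'
    using that S_up[OF _ that(2,3)] unfolding T_iff by auto
  have Tv: "T (?y v) (?z v)" unfolding T_iff S_def using v(1) by blast
  have Tq: "T (?y (e q)) (?z (e q))" unfolding T_iff by simp
  have "?y v < ?y (e q) \<or> ?z v < ?z (e q)"
    using v x0[OF M[OF v(1)]] x0[OF e(2)[OF q(1)]] by (auto simp: xyz_exp_le_iff)
  hence "\<exists>b c. \<not> T b c \<and> T (Suc b) c \<and> T b (Suc c)"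
  proof
    assume less: "?y v < ?y (e q)"
    have "\<not> T (?y (e q) - 1) (?z (e q))"
      using S_up[of "?y (e q) - 1" "?z (e q)"] not_S less unfolding T_iff by auto
    with T_up Tq show ?thesis using Tv less by (rule staircase_corner)
  next
    assume less: "?z v < ?z (e q)"
    have "\<not> T (?y (e q)) (?z (e q) - 1)"
      using S_up[of "?y (e q)" "?z (e q) - 1"] not_S less unfolding T_iff by auto
    with T_up Tq have "\<exists>c b. \<not> T b c \<and> T b (Suc c) \<and> T (Suc b) c"
      using Tv less by (intro staircase_corner[where T = "\<lambda>c b. T b c"])
    thus ?thesis by blast
  qed
  then obtain b c where bc: "\<not> T b c" "T (Suc b) c" "T b (Suc c)" by blast

  have "depth Kxyz max_ideal_xyz (quot_module Kxyz I) \<le> 1"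
    unfolding I using bc unfolding T_def by (rule depth_le_one_if_corner)
  moreover have "1 \<le> depth Kxyz max_ideal_xyz (quot_module Kxyz I)"
    unfolding I
  proof (rule one_le_depth_if_slices)
    show "0 \<notin> multiples X"
      using bc(1) multiples_mono[of 0 X "xyz_exp (i p) b c"] by (auto simp: T_def exp_le_def)
  next
    fix k assume "i p \<le> ?x k" "k + Poly_Mapping.single VX 1 \<in> multiples X"
    thus "k \<in> multiples X"
      using i_mono[of _ p] unfolding mem_X
      by (auto simp: lookup_add lookup_single intro: order_trans[OF less_imp_le])
  next
    fix a assume a: "a < i p"
    \<comment> \<open>The slice is generated by the last \<open>u\<^sub>j\<close> available in it, since that one divides all earlier
      ones; \<open>i\<^sub>0 = 0\<close> makes at least one available.\<close>
    define j where "j = Max {j. j < p \<and> i j \<le> a}"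
    have fin: "finite {j. j < p \<and> i j \<le> a}" by simp
    have "0 \<in> {j. j < p \<and> i j \<le> a}" using assms(1,2) by simp
    hence "j \<in> {j. j < p \<and> i j \<le> a}" unfolding j_def using fin by (intro Max_in) auto
    hence j: "j < p" "i j \<le> a" by auto
    have below: "e j \<preceq> e l" if "l < p" "i l \<le> a" for l
      using e_anti[of l j] j(1) Max_ge[OF fin, of l] that by (simp add: j_def)
    have "k \<in> multiples X \<longleftrightarrow> ?y (e j) \<le> ?y k \<and> ?z (e j) \<le> ?z k" if k: "?x k = a" for k
    proof -
      have "?y (e j) \<le> ?y k \<and> ?z (e j) \<le> ?z k"
        if "l < p" "i l \<le> a" "?y (e l) \<le> ?y k" "?z (e l) \<le> ?z k" for l
        using below[OF that(1,2)] that(3,4) by (simp add: xyz_exp_le_iff)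
      thus ?thesis using a j unfolding mem_X k by auto
    qed
    thus "\<exists>B C. \<forall>k. ?x k = a \<longrightarrow> (k \<in> multiples X \<longleftrightarrow> B \<le> ?y k \<and> C \<le> ?z k)" by blast
  qed
  ultimately show ?thesis by (rule antisym)
qed

end
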